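(* Let $\alpha,\beta\in\mathbb{R}$ satisfy $\alpha\ge 0$, $\alpha+\beta\ge 0$ and $(\alpha,\beta)\neq(0,0)$. Then for every integer $n\ge 2$, $$F_n^{(\alpha,\beta)}(x)\preceq F_{n+1}^{(\alpha,\beta)}(x),$$ that is, $F_n^{(\alpha,\beta)}(x)$ interlaces $F_{n+1}^{(\alpha,\beta)}(x)$.
   Context: For $n\ge 0$ let $$N_{A_n}(x)=\frac{1}{n+1}\sum_{k=0}^{n}\binom{n+1}{k}\binom{n+1}{k+1}x^k,\qquad N_{B_n}(x)=\sum_{k=0}^n\binom{n}{k}^2x^k,$$ and for $n\ge 2$ and $\alpha,\beta\in\mathbb{R}$ let $$F_n^{(\alpha,\beta)}(x)=\alpha N_{B_n}(x)+\beta\, n x\, N_{A_{n-2}}(x).$$ Interlacing: for two polynomials $f(x),g(x)$ with real coefficients, positive leading coefficients and only real zeros, $g$ interlaces $f$, written $g\preceq f$, if $\cdots\le s_2\le r_2\le s_1\le r_1$, where $r_1\ge r_2\ge\cdots$ are all the zeros of $f$ and $s_1\ge s_2\ge\cdots$ all the zeros of $g$, counted with multiplicity (so $\deg f=\deg g$ or $\deg f=\deg g+1$). In particular the relation $g\preceq f$ includes the assertion that $f$ and $g$ have only real zeros. *)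

theory Defs
  imports Complex_Main "HOL-Computational_Algebra.Computational_Algebra"
begin

definition narayana_A :: "nat \<Rightarrow> real poly" where
  "narayana_A n = smult (1 / real (n + 1))
     (\<Sum>k=0..n. monom (real ((n + 1) choose k) * real ((n + 1) choose (k + 1))) k)"

definition narayana_B :: "nat \<Rightarrow> real poly" where
  "narayana_B n = (\<Sum>k=0..n. monom ((real (n choose k))\<^sup>2) k)"

(* Only meaningful for n \<ge> 2, because n - 2 is truncated subtraction. *)
definition F_poly :: "nat \<Rightarrow> real \<Rightarrow> real \<Rightarrow> real poly" where
  "F_poly n \<alpha> \<beta> =
     smult \<alpha> (narayana_B n) + smult (\<beta> * real n) ([:0, 1:] * narayana_A (n - 2))"

(* Zeros are taken over the complex numbers; constants vacuously have only real zeros. *)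
definition only_real_zeros :: "real poly \<Rightarrow> bool" where
  "only_real_zeros p \<longleftrightarrow>
     (\<forall>z::complex. poly (map_poly complex_of_real p) z = 0 \<longrightarrow> z \<in> \<real>)"

(* Real zeros in weakly decreasing order, each repeated according to its multiplicity;
   the entry with index i is the (i+1)-st largest zero. *)
definition zeros_desc :: "real poly \<Rightarrow> real list" where
  "zeros_desc p = rev (sorted_list_of_multiset (proots p))"

definition interlaces :: "real poly \<Rightarrow> real poly \<Rightarrow> bool"  (infix "\<preceq>" 50) where
  "g \<preceq> f \<longleftrightarrow>
     lead_coeff f > 0 \<and> lead_coeff g > 0 \<and>
     only_real_zeros f \<and> only_real_zeros g \<and>
     (degree f = degree g \<or> degree f = degree g + 1) \<and>
     (let r = zeros_desc f; s = zeros_desc g in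
        (\<forall>i < length s. s ! i \<le> r ! i) \<and>
        (\<forall>i. i + 1 < length r \<longrightarrow> r ! (i + 1) \<le> s ! i))"

end

theory Submission
  imports Defs
begin

text \<open>For \<open>x < 0\<close> put \<open>t = (1 + x) / (1 - x) \<in> (-1, 1)\<close>. Then \<open>p\<^sub>n = N\<^bsub>B_n\<^esub>(x) / (1 - x)\<^sup>n\<close>
  is the Legendre polynomial \<open>P\<^sub>n(t)\<close>, and \<open>F\<^sub>n(x) / (1 - x)\<^sup>n = G\<^sub>n :=
  \<alpha> p\<^sub>n + \<beta>/2 (t p\<^sub>n\<^sub>-\<^sub>1 - p\<^sub>n\<^sub>-\<^sub>2)\<close>.
  At a zero of \<open>p\<^sub>n\<^sub>-\<^sub>1\<close>, \<open>G\<^sub>n\<close> is a nonnegative multiple of \<open>p\<^sub>n\<close>, so the zeros of \<open>F\<^sub>n\<close> separate those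
  of \<open>N\<^bsub>B_(n-1)\<^esub>\<close>; and at a zero of \<open>G\<^sub>n\<close>, \<open>G\<^sub>n\<^sub>+\<^sub>1\<close> and \<open>p\<^sub>n\<^sub>-\<^sub>1\<close> have opposite signs, so
  \<open>F\<^sub>n\<^sub>+\<^sub>1\<close> alternates in sign along the zeros of \<open>F\<^sub>n\<close>. The second fact follows from Laguerre's
  inequality \<open>P\<^sub>n'\<^sup>2 - P\<^sub>n P\<^sub>n'' > 0\<close>, which in terms of \<open>p\<^sub>n\<close> and \<open>p\<^sub>n\<^sub>-\<^sub>1\<close> is a sum of squares.
  The degenerate cases are \<open>\<alpha> = 0\<close>, where \<open>F\<^sub>n\<close> is a multiple of \<open>x N\<^bsub>A_(n-2)\<^esub>\<close>, and \<open>n = 2\<close>,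
  \<open>\<beta> = -\<alpha>\<close>, where \<open>F\<^sub>2 = \<alpha> (1 + x)\<^sup>2\<close>.\<close>

subsection \<open>Zeros and sign changes\<close>

definition linear_factors :: "real list \<Rightarrow> real poly" where
  "linear_factors xs = (\<Prod>x\<leftarrow>xs. [:- x, 1:])"

lemma linear_factors_simps [simp]:
  "linear_factors [] = 1"
  "linear_factors (x # xs) = [:- x, 1:] * linear_factors xs"
  by (simp_all add: linear_factors_def)

lemma linear_factors_nonzero [simp]: "linear_factors xs \<noteq> 0"
  by (induction xs) (simp_all del: mult_pCons_left)

lemma degree_linear_factors [simp]: "degree (linear_factors xs) = length xs"
  by (induction xs) (simp_all del: mult_pCons_left add: degree_mult_eq)

lemma lead_coeff_linear_factors [simp]: "coeff (linear_factors xs) (length xs) = 1"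
proof -
  have "lead_coeff (linear_factors xs) = 1"
    by (induction xs) (simp_all del: mult_pCons_left degree_linear_factors add: lead_coeff_mult)
  then show ?thesis by simp
qed

lemma poly_prod_linear:
  fixes z :: "'a :: comm_ring_1"
  shows "poly (\<Prod>x\<leftarrow>xs. [:- h x, 1:]) z = (\<Prod>x\<leftarrow>xs. z - h x)"
  by (induction xs) (simp_all add: algebra_simps)

lemma poly_linear_factors: "poly (linear_factors xs) z = (\<Prod>x\<leftarrow>xs. z - x)"
  by (simp add: linear_factors_def poly_prod_linear)

lemma proots_linear_factors [simp]: "proots (linear_factors xs) = mset xs"
  by (induction xs) (simp_all del: mult_pCons_left add: proots_mult)

lemma only_real_zeros_linear_factors:
  assumes "c > 0"
  shows "only_real_zeros (smult c (linear_factors xs))"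
proof -
  have "map_poly complex_of_real (linear_factors xs) =
    (\<Prod>x\<leftarrow>xs. [:- complex_of_real x, 1:])"
  proof (induction xs)
    case (Cons x xs)
    then show ?case by (intro poly_eqI) (simp add: coeff_map_poly coeff_pCons split: nat.split flip: Cons.IH)
  qed simp
  then have "poly (map_poly complex_of_real (smult c (linear_factors xs))) z =
    complex_of_real c * (\<Prod>x\<leftarrow>xs. z - complex_of_real x)" for z
    by (simp add: map_poly_smult poly_prod_linear)
  then show ?thesis
    using assms by (auto simp: only_real_zeros_def prod_list_zero_iff)
qed

lemma zeros_desc_linear_factors:
  assumes "c > 0" and "sorted_wrt (\<ge>) xs"
  shows "zeros_desc (smult c (linear_factors xs)) = xs"
proof -
  have "sort xs = rev xs"
    using assms(2) by (intro properties_for_sort) (simp_all add: sorted_wrt_rev)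
  then show ?thesis
    using assms(1) by (simp add: zeros_desc_def)
qed

text \<open>Weakly sorted lists and weak inequalities serve the degenerate cases: for \<alpha> = 0
  both polynomials vanish at 0, and for \<beta> = -\<alpha> the first one has the double zero
  -1.\<close>

lemma interlaces_linear_factors:
  assumes "g = smult c (linear_factors xs)" "f = smult d (linear_factors ys)"
    and "c > 0" "d > 0"
    and "sorted_wrt (\<ge>) xs" "sorted_wrt (\<ge>) ys"
    and "length ys = length xs \<or> length ys = length xs + 1"
    and "\<And>i. i < length xs \<Longrightarrow> xs ! i \<le> ys ! i"
    and "\<And>i. i + 1 < length ys \<Longrightarrow> ys ! (i + 1) \<le> xs ! i"
  shows "g \<preceq> f"
  using assms
  by (simp add: interlaces_def zeros_desc_linear_factors only_real_zeros_linear_factors Let_def)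

text \<open>Indices start at the largest zero, as in \<open>zeros_desc\<close>. Since the degree is
  m, the values y 0 > ... > y (m - 1) exhaust the zeros.\<close>

definition simple_zeros :: "real poly \<Rightarrow> nat \<Rightarrow> (nat \<Rightarrow> real) \<Rightarrow> bool" where
  "simple_zeros f m y \<longleftrightarrow> degree f = m \<and> lead_coeff f > 0 \<and>
     (\<forall>i<m. poly f (y i) = 0) \<and> (\<forall>i j. i < j \<longrightarrow> j < m \<longrightarrow> y j < y i)"

text \<open>Both sides have the same coefficient in degree m and agree at m points, so their
  difference has degree below m and too many zeros.\<close>

lemma simple_zeros_factorisation:
  assumes "simple_zeros f m y"
  shows "f = smult (lead_coeff f) (linear_factors (map y [0..<m]))"
proof (rule poly_eqI_degree_lead_coeff[where n = m and A = "y ` {..<m}"])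
  have "inj_on y {..<m}"
    using assms unfolding simple_zeros_def inj_on_def
    by (metis lessThan_iff less_irrefl linorder_neqE_nat)
  then show "m \<le> card (y ` {..<m})" by (simp add: card_image)
  show "poly f z = poly (smult (lead_coeff f) (linear_factors (map y [0..<m]))) z"
    if "z \<in> y ` {..<m}" for z
  proof -
    from that obtain i where "i < m" "z = y i" by auto
    then show ?thesis
      using assms by (force simp: simple_zeros_def poly_linear_factors prod_list_zero_iff)
  qed
  have "coeff (linear_factors (map y [0..<m])) m = 1"
    using lead_coeff_linear_factors[of "map y [0..<m]"] by simp
  then show "coeff f m = coeff (smult (lead_coeff f) (linear_factors (map y [0..<m]))) m"
    using assms by (simp add: simple_zeros_def)
qed (use assms in \<open>simp_all add: simple_zeros_def\<close>)

lemma simple_zeros_sorted: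
  assumes "simple_zeros f m y"
  shows "sorted_wrt (\<ge>) (map y [0..<m])"
  using assms by (auto simp: simple_zeros_def sorted_wrt_iff_nth_less intro: less_imp_le)

text \<open>At x exactly the first k linear factors are negative.\<close>

lemma simple_zeros_sign:
  assumes "simple_zeros f m y" "k \<le> m"
    and above: "\<And>i. i < k \<Longrightarrow> x < y i" and below: "\<And>i. k \<le> i \<Longrightarrow> i < m \<Longrightarrow> y i < x"
  shows "(-1) ^ k * poly f x > 0"
proof -
  have "(-1) ^ k * (\<Prod>i<m. x - y i) > 0"
  proof -
    have "{..<m} = {..<k} \<union> {k..<m}" using assms(2) by auto
    then have "(\<Prod>i<m. x - y i) = (\<Prod>i<k. x - y i) * (\<Prod>i=k..<m. x - y i)"
      by (simp add: prod.union_disjoint ivl_disj_int)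
    moreover have "(-1) ^ k * (\<Prod>i<k. x - y i) = (\<Prod>i<k. y i - x)"
      using prod.distrib[of "\<lambda>_. - 1 :: real" "\<lambda>i. x - y i" "{..<k}"] by simp
    moreover have "(\<Prod>i<k. y i - x) > 0" "(\<Prod>i=k..<m. x - y i) > 0"
      using above below by (auto intro!: prod_pos)
    ultimately show ?thesis by (metis mult.assoc mult_pos_pos)
  qed
  moreover have "poly f x = lead_coeff f * (\<Prod>i<m. x - y i)"
    by (subst simple_zeros_factorisation[OF assms(1)])
      (simp add: poly_linear_factors prod.list_conv_set_nth o_def atLeast0LessThan)
  moreover have "lead_coeff f > 0" using assms(1) unfolding simple_zeros_def by blast
  ultimately show ?thesis by (metis mult.left_commute mult_pos_pos)
qed

section \<open>Zeros forced by sign changes\<close>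

lemma alternating_signs_imp_zeros:
  fixes f :: "real poly"
  assumes w: "\<And>i j. i < j \<Longrightarrow> j \<le> k \<Longrightarrow> w j < w i"
    and sign: "\<And>i. i \<le> k \<Longrightarrow> (-1) ^ i * poly f (w i) > 0"
  obtains y where "\<And>i. i < k \<Longrightarrow> w (Suc i) < y i" "\<And>i. i < k \<Longrightarrow> y i < w i"
    "\<And>i. i < k \<Longrightarrow> poly f (y i) = 0" "\<And>i j. i < j \<Longrightarrow> j < k \<Longrightarrow> y j < y i"
proof -
  have "\<exists>x. w (Suc i) < x \<and> x < w i \<and> poly f x = 0" if "i < k" for i
  proof -
    have "(-1) ^ i * poly f (w i) > 0" "(-1) ^ i * poly f (w (Suc i)) < 0"
      using sign[of i] sign[of "Suc i"] that by simp_all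
    then have "poly f (w (Suc i)) * poly f (w i) < 0"
      by (cases "even i") (simp_all add: mult_neg_pos mult_pos_neg)
    then show ?thesis using poly_IVT[of "w (Suc i)" "w i" f] w[of i "Suc i"] that by simp
  qed
  then obtain y where y: "\<And>i. i < k \<Longrightarrow> w (Suc i) < y i" "\<And>i. i < k \<Longrightarrow> y i < w i"
    "\<And>i. i < k \<Longrightarrow> poly f (y i) = 0"
    by metis
  have "y j < y i" if "i < j" "j < k" for i j
  proof -
    have "w j \<le> w (Suc i)" using w[of "Suc i" j] that by (cases "Suc i = j") auto
    then show ?thesis using y(1)[of i] y(2)[of j] that by linarith
  qed
  with y show ?thesis by (rule that)
qed

text \<open>With d the degree, (-1)^d f(-x) has the same leading coefficient as f, so it is
  eventually positive.\<close>

lemma poly_sign_at_bot: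
  fixes f :: "real poly"
  assumes "lead_coeff f > 0"
  obtains x where "x < b" "(-1) ^ degree f * poly f x > 0"
proof -
  let ?g = "smult ((-1) ^ degree f) (pcompose f [:0, -1:])"
  have "lead_coeff (pcompose f [:0, -1:]) = lead_coeff f * (-1) ^ degree f"
    by (subst lead_coeff_comp) simp_all
  then have "lead_coeff ?g = lead_coeff f * ((-1) ^ degree f * (-1) ^ degree f)"
    by (simp only: lead_coeff_smult mult_ac)
  then have "lead_coeff ?g > 0"
    using assms by (simp only: power_mult_distrib[symmetric]) simp
  from poly_pinfty_gt_lc[OF this] obtain N where N: "\<And>x. x \<ge> N \<Longrightarrow> poly ?g x > 0"
    using \<open>lead_coeff ?g > 0\<close> by (meson less_le_trans)
  have "max N (1 - b) \<ge> N" "- max N (1 - b) < b" by linarith+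
  then show ?thesis
    using N[of "max N (1 - b)"] by (intro that[of "- max N (1 - b)"]) (simp_all add: poly_pcompose)
qed

text \<open>The step from one polynomial to the next: the m prescribed signs, the positive value at
  0 and the sign near minus infinity give m + 2 alternating points, hence m + 1 zeros, as many as
  the degree allows. The sign of g at these zeros is recorded because the recurrences convert it
  into the sign of the next polynomial.\<close>

lemma simple_zeros_Suc:
  assumes g: "simple_zeros g m z" "\<And>i. i < m \<Longrightarrow> z i < 0"
    and f: "degree f = Suc m" "lead_coeff f > 0" "poly f 0 > 0"
    and sign: "\<And>i. i < m \<Longrightarrow> (-1) ^ i * poly f (z i) < 0"
  obtains y where "simple_zeros f (Suc m) y" "\<And>i. i < Suc m \<Longrightarrow> y i < 0"
    "\<And>i. i < Suc m \<Longrightarrow> (-1) ^ i * poly g (y i) > 0"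
    "\<And>i. i < m \<Longrightarrow> z i < y i" "\<And>i. i < m \<Longrightarrow> y (Suc i) < z i"
proof -
  obtain b where b: "b < Min (insert 0 (z ` {..<m}))" "(-1) ^ Suc m * poly f b > 0"
    using poly_sign_at_bot[OF f(2), of "Min (insert 0 (z ` {..<m}))"] unfolding f(1) by blast
  \<comment> \<open>The test points in decreasing order: 0, the zeros of g, then b. The index shift
    turns the negative sign in the hypothesis into an alternation that starts with a positive
    value.\<close>
  define w where "w i = (case i of 0 \<Rightarrow> 0 | Suc j \<Rightarrow> if j < m then z j else b)" for i
  have w_simps: "w 0 = 0" "w (Suc i) = (if i < m then z i else b)" for i
    by (simp_all add: w_def)
  have b: "b < 0" "\<And>i. i < m \<Longrightarrow> b < z i" "(-1) ^ Suc m * poly f b > 0"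
    using b by simp_all
  have z: "\<And>i j. i < j \<Longrightarrow> j < m \<Longrightarrow> z j < z i"
    using g(1) by (simp add: simple_zeros_def)
  have w: "w j < w i" if "i < j" "j \<le> Suc m" for i j
    using that b(1,2) z g(2) by (cases i; cases j) (simp_all add: w_simps)
  have w_sign: "(-1) ^ i * poly f (w i) > 0" if "i \<le> Suc m" for i
  proof (cases i)
    case (Suc j)
    then show ?thesis
      using that b(3) sign[of j] by (cases "j < m") (simp_all add: w_simps not_less le_antisym)
  qed (simp add: w_simps f)
  obtain y where y: "\<And>i. i < Suc m \<Longrightarrow> w (Suc i) < y i" "\<And>i. i < Suc m \<Longrightarrow> y i < w i"
    "\<And>i. i < Suc m \<Longrightarrow> poly f (y i) = 0" "\<And>i j. i < j \<Longrightarrow> j < Suc m \<Longrightarrow> y j < y i"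
    using alternating_signs_imp_zeros[of "Suc m" w f, OF w w_sign] by blast
  have zy: "z i < y i" "y (Suc i) < z i" if "i < m" for i
    using y(1)[of i] y(2)[of "Suc i"] that by (auto simp: w_simps)
  show ?thesis
  proof (rule that)
    show "simple_zeros f (Suc m) y" using f y(3,4) by (simp add: simple_zeros_def)
    show "y i < 0" if "i < Suc m" for i
      using y(2)[OF that] w[of 0 i] that by (cases "i = 0") (auto simp: w_simps(1))
    show "(-1) ^ i * poly g (y i) > 0" if i: "i < Suc m" for i
    proof (rule simple_zeros_sign[OF g(1)])
      show "y i < z j" if "j < i" for j
        using w[of "Suc j" i] y(2)[OF i] that i by (cases "Suc j = i") (auto simp: w_simps(2))
      show "z j < y i" if "i \<le> j" "j < m" for j
        using w[of "Suc i" "Suc j"] y(1)[OF i] that by (cases "i = j") (auto simp: w_simps(2))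
    qed (use i in simp)
  qed (use zy in auto)
qed

lemma simple_zeros_interlaces:
  assumes "simple_zeros g m s" "simple_zeros f (Suc m) r"
    and "\<And>i. i < m \<Longrightarrow> s i < r i" "\<And>i. i < m \<Longrightarrow> r (Suc i) < s i"
  shows "g \<preceq> f"
proof (rule interlaces_linear_factors[OF simple_zeros_factorisation[OF assms(1)]
      simple_zeros_factorisation[OF assms(2)]])
  show "map s [0..<m] ! i \<le> map r [0..<Suc m] ! i" if "i < length (map s [0..<m])" for i
    using that assms(3) by (simp add: less_imp_le nth_append del: upt_Suc)
  show "map r [0..<Suc m] ! (i + 1) \<le> map s [0..<m] ! i"
    if "i + 1 < length (map r [0..<Suc m])" for i
    using that assms(4) by (simp add: less_imp_le del: upt_Suc)
  show "lead_coeff g > 0" "lead_coeff f > 0"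
    using assms(1,2) unfolding simple_zeros_def by blast+
qed (simp_all add: simple_zeros_sorted[OF assms(1)] simple_zeros_sorted[OF assms(2)] del: upt_Suc)

subsection \<open>Narayana polynomials\<close>

lemma coeff_narayana_B: "coeff (narayana_B n) k = (real (n choose k))\<^sup>2"
  by (auto simp: narayana_B_def coeff_sum sum.delta' binomial_eq_0)

lemma coeff_narayana_A:
  "coeff (narayana_A n) k = real (Suc n choose k) * real (Suc n choose Suc k) / real (Suc n)"
  by (auto simp: narayana_A_def coeff_sum sum.delta' binomial_eq_0)

section \<open>Identities between consecutive Narayana polynomials\<close>

lemma binomial_ratio:
  "real (Suc k) * real (n choose Suc k) = (real n - real k) * real (n choose k)"
proof (cases "k \<le> n")
  case True
  have "Suc k * (n choose Suc k) = (n - k) * (n choose k)"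
    by (simp only: binomial_absorption binomial_absorb_comp diff_Suc_1)
  then have "real (Suc k * (n choose Suc k)) = real ((n - k) * (n choose k))" by (rule arg_cong)
  with True show ?thesis by (simp add: of_nat_diff algebra_simps del: binomial_Suc_Suc)
qed (simp add: binomial_eq_0)

text \<open>After Pascal's rule, comparing coefficients in the two polynomial identities below comes
  down to this relation. Ratios of neighbouring binomial coefficients express a and b through
  c.\<close>

lemma binomial_consecutive:
  fixes n k :: nat
  defines "a \<equiv> real (n choose Suc (Suc k))" and "b \<equiv> real (n choose Suc k)"
    and "c \<equiv> real (n choose k)"
  shows "(real n + 2) * a * c + a * b + b * c = real n * b\<^sup>2"
proof -
  have "(real k + 2) * a = (real n - real k - 1) * b" "(real k + 1) * b = (real n - real k) * c"
    using binomial_ratio[of "Suc k" n] binomial_ratio[of k n]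
    by (simp_all add: a_def b_def c_def algebra_simps)
  then have a: "a = (real n - real k - 1) * b / (real k + 2)"
    and b: "b = (real n - real k) * c / (real k + 1)"
    by (simp_all add: eq_divide_eq mult.commute)
  show ?thesis unfolding a b by (simp add: divide_simps power2_eq_square) (simp add: algebra_simps)
qed

text \<open>Bonnet's recurrence for Legendre polynomials with t = (1 + x) / (1 - x), cleared of
  denominators; \<open>[:1, -2, 1:]\<close> is (1 - x)^2.\<close>

lemma narayana_B_recurrence:
  "smult (real n + 2) (narayana_B (Suc (Suc n))) =
     smult (2 * real n + 3) ([:1, 1:] * narayana_B (Suc n))
     - smult (real n + 1) ([:1, -2, 1:] * narayana_B n)"
proof (rule poly_eqI)
  fix i
  consider "i = 0" | "i = 1" | k where "i = Suc (Suc k)"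
    by (metis One_nat_def not0_implies_Suc)
  then show "coeff (smult (real n + 2) (narayana_B (Suc (Suc n)))) i =
     coeff (smult (2 * real n + 3) ([:1, 1:] * narayana_B (Suc n))
     - smult (real n + 1) ([:1, -2, 1:] * narayana_B n)) i"
  proof cases
    case 3
    show ?thesis
      using binomial_consecutive[of n k]
      by (simp add: 3 coeff_narayana_B power2_eq_square) (simp add: algebra_simps)
  qed (simp_all add: coeff_narayana_B coeff_pCons power2_eq_square algebra_simps)
qed

text \<open>This makes \<open>F_poly\<close> a combination of three consecutive type B polynomials,
  so that a single recurrence governs it.\<close>

lemma narayana_A_eq_narayana_B:
  "smult (2 * (real n + 2)) ([:0, 1:] * narayana_A n) =
     [:1, 1:] * narayana_B (Suc n) - [:1, -2, 1:] * narayana_B n"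
proof (rule poly_eqI)
  fix i
  consider "i = 0" | "i = 1" | k where "i = Suc (Suc k)"
    by (metis One_nat_def not0_implies_Suc)
  then show "coeff (smult (2 * (real n + 2)) ([:0, 1:] * narayana_A n)) i =
     coeff ([:1, 1:] * narayana_B (Suc n) - [:1, -2, 1:] * narayana_B n) i"
  proof cases
    case 3
    show ?thesis
      using binomial_consecutive[of n k]
      by (simp add: 3 coeff_narayana_B coeff_narayana_A power2_eq_square divide_simps)
        (simp add: algebra_simps)
  qed (simp_all add: coeff_narayana_B coeff_narayana_A coeff_pCons power2_eq_square field_simps)
qed

lemma poly_narayana_B_recurrence:
  "(real n + 2) * poly (narayana_B (Suc (Suc n))) x =
     (2 * real n + 3) * (1 + x) * poly (narayana_B (Suc n)) x
     - (real n + 1) * (1 - x)\<^sup>2 * poly (narayana_B n) x"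
  using arg_cong[OF narayana_B_recurrence[of n], of "\<lambda>p. poly p x"]
  by (simp add: power2_eq_square algebra_simps)

lemma poly_narayana_A:
  "2 * (real n + 2) * (x * poly (narayana_A n) x) =
     (1 + x) * poly (narayana_B (Suc n)) x - (1 - x)\<^sup>2 * poly (narayana_B n) x"
  using arg_cong[OF narayana_A_eq_narayana_B[of n], of "\<lambda>p. poly p x"]
  by (simp add: power2_eq_square algebra_simps)

lemma poly_F_poly:
  "poly (F_poly (Suc (Suc n)) \<alpha> \<beta>) x = \<alpha> * poly (narayana_B (Suc (Suc n))) x
     + \<beta> / 2 * ((1 + x) * poly (narayana_B (Suc n)) x - (1 - x)\<^sup>2 * poly (narayana_B n) x)"
  unfolding poly_narayana_A[symmetric] by (simp add: F_poly_def algebra_simps)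

lemma degree_narayana_B [simp]: "degree (narayana_B n) = n"
  by (rule antisym) (auto intro!: degree_le le_degree simp: coeff_narayana_B binomial_eq_0)

lemma degree_narayana_A [simp]: "degree (narayana_A n) = n"
  by (rule antisym)
    (auto intro!: degree_le le_degree simp: coeff_narayana_A binomial_eq_0 simp del: binomial_Suc_Suc)

lemma poly_narayana_at_0 [simp]: "poly (narayana_B n) 0 = 1" "poly (narayana_A n) 0 = 1"
  by (simp_all add: poly_0_coeff_0 coeff_narayana_B coeff_narayana_A)

lemma coeff_F_poly_n: "coeff (F_poly (Suc (Suc n)) \<alpha> \<beta>) (Suc (Suc n)) = \<alpha>"
  by (simp add: F_poly_def coeff_narayana_B coeff_narayana_A binomial_eq_0)

lemma degree_F_poly: "\<alpha> \<noteq> 0 \<Longrightarrow> degree (F_poly (Suc (Suc n)) \<alpha> \<beta>) = Suc (Suc n)"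
proof (rule antisym)
  show "degree (F_poly (Suc (Suc n)) \<alpha> \<beta>) \<le> Suc (Suc n)"
    unfolding F_poly_def
    by (intro degree_add_le order.trans[OF degree_smult_le])
      (simp_all add: degree_pCons_eq_if)
qed (simp add: le_degree coeff_F_poly_n)

subsection \<open>Legendre sequences\<close>

text \<open>Serves the case \<beta> > 0 of \<open>next_term_sign\<close>, with s the square of t and
  l the ratio in p (n + 2) = l t p (n + 1). The last hypothesis is Laguerre's inequality divided by
  the square of p (n + 1).\<close>

lemma quadratic_pos_of_laguerre:
  fixes n s l :: real
  assumes "n \<ge> 2" "0 \<le> s" "s < 1" "0 < l" "l < 1"
    and lag: "n - 2 * (n + 1) * l * s + (n + 1 + s) * l\<^sup>2 * s > 0"
  shows "(n\<^sup>2 + n + 1) * l\<^sup>2 * s - (1 + n * (2 * n + 1) * s) * l + n\<^sup>2 > 0" (is "?K > 0")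
proof (cases "n * s \<ge> 1")
  case True
  \<comment> \<open>\<open>?K\<close> is n times the Laguerre expression plus a term that is
    nonnegative because n s \<ge> 1.\<close>
  have "?K = n * (n - 2 * (n + 1) * l * s + (n + 1 + s) * l\<^sup>2 * s) + l * (n * s - 1) * (1 - l * s)"
    by (simp add: power2_eq_square algebra_simps)
  moreover have "l * s \<le> 1" using assms by (intro mult_le_one) auto
  then have "l * (n * s - 1) * (1 - l * s) \<ge> 0" using assms True by simp
  moreover have "n * (n - 2 * (n + 1) * l * s + (n + 1 + s) * l\<^sup>2 * s) > 0"
    using lag assms by simp
  ultimately show ?thesis by linarith
next
  case False
  have "n\<^sup>2 - (n\<^sup>2 + n + 1) * s > 0"
  proof -
    have "n * (n\<^sup>2 - (n\<^sup>2 + n + 1) * s) = n ^ 3 - (n\<^sup>2 + n + 1) * (n * s)"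
      by (simp add: power2_eq_square power3_eq_cube algebra_simps)
    moreover have "(n\<^sup>2 + n + 1) * (n * s) \<le> (n\<^sup>2 + n + 1) * 1"
      using False assms by (intro mult_left_mono) auto
    moreover have "n ^ 3 > n\<^sup>2 + n + 1"
    proof -
      have "n * n \<ge> 2 * n" "n * (n * n) \<ge> 2 * (n * n)" using assms by (auto intro: mult_right_mono)
      then show ?thesis using assms(1) unfolding power2_eq_square power3_eq_cube mult.assoc by linarith
    qed
    ultimately have "n * (n\<^sup>2 - (n\<^sup>2 + n + 1) * s) > 0" by simp
    then show ?thesis using assms by (simp add: zero_less_mult_iff)
  qed
  \<comment> \<open>At l = 1, \<open>?K\<close> equals (n^2 - 1)(1 - s). Splitting off l times this
    value leaves a multiple of 1 - l, which is then expanded around l = 1.\<close>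
  then have "(1 - l) * (n\<^sup>2 - (n\<^sup>2 + n + 1) * s) > 0" using assms by simp
  moreover have "n\<^sup>2 > 1" using assms by (simp add: power_gt1_lemma one_less_power)
  then have "l * ((n\<^sup>2 - 1) * (1 - s)) > 0" using assms by simp
  moreover have "(n\<^sup>2 + n + 1) * s * (l - 1)\<^sup>2 \<ge> 0" using assms by simp
  moreover have "?K = (1 - l) * (n\<^sup>2 - (n\<^sup>2 + n + 1) * s) + l * ((n\<^sup>2 - 1) * (1 - s))
      + (n\<^sup>2 + n + 1) * s * (l - 1)\<^sup>2"
    by (simp add: power2_eq_square algebra_simps)
  ultimately show ?thesis by linarith
qed

text \<open>Bonnet's recurrence at one fixed t in (-1, 1). The sign argument is pointwise, so a
  sequence of real numbers suffices.\<close>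

locale legendre_sequence =
  fixes t :: real and p :: "nat \<Rightarrow> real"
  assumes p_0: "p 0 = 1" and p_1: "p 1 = t"
    and p_rec: "(real n + 2) * p (Suc (Suc n)) = (2 * real n + 3) * t * p (Suc n) - (real n + 1) * p n"
    and t_bound: "t\<^sup>2 < 1"
begin

text \<open>The left-hand side is \<open>(1 - t\<^sup>2)\<^sup>2 (P'\<^sup>2 - P P'') / (n + 1)\<close> for \<open>P = P\<^sub>n\<^sub>+\<^sub>1\<close>, with the derivatives
  eliminated by \<open>(1 - t\<^sup>2) P' = (n + 1) (P\<^sub>n - t P)\<close> and Legendre's differential equation.\<close>

lemma laguerre_inequality:
  "(real n + 1) * (p n)\<^sup>2 - 2 * (real n + 2) * t * p (Suc n) * p n
     + (real n + 2 + t\<^sup>2) * (p (Suc n))\<^sup>2 > 0" (is "?L n > 0")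
proof (induction n)
  case 0
  have "?L 0 = (1 - t\<^sup>2)\<^sup>2"
    using p_0 p_1 by (simp add: power2_eq_square algebra_simps)
  then show ?case using t_bound by simp
next
  case (Suc n)
  let ?a = "p (Suc (Suc n))" and ?b = "p (Suc n)" and ?c = "p n"
  \<comment> \<open>The increment: (n + 1) \<open>?L n\<close> grows by (n + 2) \<open>?E\<close>
    when n increases by one, and \<open>?E\<close> is a sum of squares.\<close>
  let ?E = "((1 + t)\<^sup>2 * (?a - ?b)\<^sup>2 + (1 - t)\<^sup>2 * (?a + ?b)\<^sup>2) / 2"
  have c: "(real n + 1) * ?c = (2 * real n + 3) * t * ?b - (real n + 2) * ?a"
    using p_rec[of n] by simp
  have "(real n + 1) * ?L n = ((real n + 1) * ?c)\<^sup>2 - 2 * (real n + 2) * t * ?b * ((real n + 1) * ?c)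
      + (real n + 1) * (real n + 2 + t\<^sup>2) * ?b\<^sup>2"
    by (simp add: power2_eq_square algebra_simps)
  then have "(real n + 2) * ?L (Suc n) = (real n + 1) * ?L n + (real n + 2) * ?E"
    unfolding c by (simp add: power2_eq_square field_simps)
  moreover have "(real n + 1) * ?L n > 0" "(real n + 2) * ?E \<ge> 0"
    using Suc.IH by simp_all
  ultimately have "(real n + 2) * ?L (Suc n) > 0" by linarith
  then show ?case by (simp only: zero_less_mult_iff) auto
qed


text \<open>At a zero of G n, both p (n + 2) and p (n + 3) are multiples of p (n + 1), so G (n + 1)
  p (n + 1) is the square of p (n + 1) times an explicit factor, up to a positive constant. It
  remains to see that this factor is negative.\<close>

lemma next_term_sign:
  fixes \<alpha> \<beta> :: real
  defines "G \<equiv> \<lambda>n. \<alpha> * p (Suc (Suc n)) + \<beta> / 2 * (t * p (Suc n) - p n)"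
  assumes "\<alpha> > 0" "\<alpha> + \<beta> \<ge> 0" "n \<ge> 1 \<or> \<alpha> + \<beta> > 0" and G: "G n = 0"
  shows "G (Suc n) * p (Suc n) < 0"
proof -
  \<comment> \<open>A zero of \<open>G n\<close> amounts to \<open>p (n + 2) = l t p (n + 1)\<close>.\<close>
  define N where "N = real n + 2"
  define \<gamma> where "\<gamma> = \<beta> / 2 * N / (N - 1)"
  define l where "l = \<gamma> / (\<alpha> + \<gamma>)"
  let ?p = "p (Suc n)" and ?q = "p (Suc (Suc n))" and ?s = "t\<^sup>2"
  have N: "N \<ge> 2" "n \<ge> 1 \<Longrightarrow> N > 2" by (simp_all add: N_def)
  have \<beta>: "\<beta> / 2 = \<gamma> * (N - 1) / N" using N by (simp add: \<gamma>_def nonzero_eq_divide_eq)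
  \<comment> \<open>Eliminating p n by the recurrence collects the coefficients of G n into \<alpha>
    + \<gamma> and -\<gamma> t; this is the origin of \<gamma>.\<close>
  have "(N - 1) * p n = (2 * N - 1) * t * ?p - N * ?q"
    using p_rec[of n] by (simp add: N_def algebra_simps)
  moreover have "(N - 1) * \<gamma> = \<beta> / 2 * N"
    using N \<beta> by (simp add: nonzero_eq_divide_eq mult.commute)
  ultimately have "(N - 1) * G n = (N - 1) * ((\<alpha> + \<gamma>) * ?q - \<gamma> * t * ?p)"
    unfolding G_def by algebra
  then have "G n = (\<alpha> + \<gamma>) * ?q - \<gamma> * t * ?p" using N by simp
  with G have q: "(\<alpha> + \<gamma>) * ?q = \<gamma> * t * ?p" by simp
  have \<alpha>\<gamma>: "\<alpha> + \<gamma> > 0"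
  proof -
    \<comment> \<open>For N = 2 the second summand vanishes, and \<alpha> + \<beta> > 0 is what
      keeps the sum positive.\<close>
    have "2 * (N - 1) * (\<alpha> + \<gamma>) = N * (\<alpha> + \<beta>) + (N - 2) * \<alpha>"
      using N by (simp add: \<gamma>_def field_simps)
    moreover have "N * (\<alpha> + \<beta>) \<ge> 0" "(N - 2) * \<alpha> \<ge> 0" using N assms by simp_all
    moreover have "N * (\<alpha> + \<beta>) > 0 \<or> (N - 2) * \<alpha> > 0" using N assms by auto
    ultimately have "2 * (N - 1) * (\<alpha> + \<gamma>) > 0" by linarith
    then show ?thesis using N by (simp add: zero_less_mult_iff)
  qed
  then have q: "?q = l * t * ?p" using q by (simp add: l_def field_simps)
  have lag: "N * ?p\<^sup>2 - 2 * (N + 1) * t * ?q * ?p + (N + 1 + ?s) * ?q\<^sup>2 > 0"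
    using laguerre_inequality[of "Suc n"] by (simp add: N_def algebra_simps)
  \<comment> \<open>If p (n + 1) were 0, then p (n + 2) would be too, against the strict
    inequality.\<close>
  then have p: "?p\<^sup>2 > 0" unfolding q by auto
  have "N * ?p\<^sup>2 - 2 * (N + 1) * t * ?q * ?p + (N + 1 + ?s) * ?q\<^sup>2
      = ?p\<^sup>2 * (N - 2 * (N + 1) * l * ?s + (N + 1 + ?s) * l\<^sup>2 * ?s)"
    unfolding q by (simp add: power2_eq_square algebra_simps)
  with lag p have lag: "N - 2 * (N + 1) * l * ?s + (N + 1 + ?s) * l\<^sup>2 * ?s > 0"
    by (simp add: zero_less_mult_iff)
  have p3: "(N + 1) * p (Suc (Suc (Suc n))) = (2 * N + 1) * t * ?q - N * ?p"
    using p_rec[of "Suc n"] by (simp add: N_def algebra_simps)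
  have G': "(N + 1) * (G (Suc n) * ?p) = ?p\<^sup>2 *
      (\<alpha> * ((2 * N + 1) * l * ?s - N) + (N + 1) * (\<beta> / 2) * (l * ?s - 1))" (is "_ = _ * ?H")
  proof -
    have "(N + 1) * (G (Suc n) * ?p) = \<alpha> * ?p * ((N + 1) * p (Suc (Suc (Suc n))))
        + (N + 1) * (\<beta> / 2) * (t * ?q - ?p) * ?p"
      unfolding G_def by (simp add: algebra_simps)
    then show ?thesis
      unfolding p3 unfolding q by (simp add: power2_eq_square field_simps)
  qed
  have "?H < 0"
  \<comment> \<open>\<open>?H\<close> is affine in l times the square of t. For \<beta> \<le> 0 that
    product is at most 0, the slope is nonnegative and the constant term negative; for \<beta> > 0
    Laguerre's inequality is called upon.\<close>
  proof (cases "\<beta> \<le> 0")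
    case True
    then have "\<gamma> \<le> 0" using N by (simp add: \<gamma>_def divide_nonpos_pos mult_nonpos_nonneg)
    then have "l * ?s \<le> 0"
      using \<alpha>\<gamma> by (simp add: l_def divide_nonpos_pos mult_nonpos_nonneg)
    moreover have "(N + 1) * (\<alpha> + \<beta>) \<ge> 0" "(N - 1) * \<alpha> > 0" using N assms by simp_all
    then have "\<alpha> * N + (N + 1) * (\<beta> / 2) > 0" by (simp add: field_simps)
    moreover note * = this
    moreover have "\<alpha> * (2 * N + 1) + (N + 1) * (\<beta> / 2) \<ge> 0"
    proof -
      have "\<alpha> * (2 * N + 1) = \<alpha> * N + \<alpha> * (N + 1)" by (simp add: algebra_simps)
      moreover have "\<alpha> * (N + 1) > 0" using N assms by simp
      ultimately show ?thesis using * by linarith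
    qed
    ultimately have "(\<alpha> * (2 * N + 1) + (N + 1) * (\<beta> / 2)) * (l * ?s)
        - (\<alpha> * N + (N + 1) * (\<beta> / 2)) < 0"
      using mult_nonneg_nonpos[of "\<alpha> * (2 * N + 1) + (N + 1) * (\<beta> / 2)" "l * ?s"] by linarith
    then show ?thesis by (simp add: field_simps)
  next
    case False
    then have \<gamma>: "\<gamma> > 0" using N by (simp add: \<gamma>_def)
    then have l: "0 < l" "l < 1" using assms by (simp_all add: l_def)
    \<comment> \<open>These two relations eliminate \<alpha> and \<beta>, and N l \<open>?H\<close>
      becomes -\<gamma> times the quadratic of \<open>quadratic_pos_of_laguerre\<close>.\<close>
    have "l * \<alpha> = \<gamma> * (1 - l)" using \<alpha>\<gamma> by (simp add: l_def field_simps)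
    moreover have "\<beta> / 2 * N = \<gamma> * (N - 1)" using N \<beta> by simp
    moreover have "?H * (N * l) = (l * \<alpha>) * (N * ((2 * N + 1) * l * ?s - N))
        + (\<beta> / 2 * N) * ((N + 1) * l * (l * ?s - 1))"
      by (simp add: field_simps)
    ultimately have "?H * (N * l) = - \<gamma> * ((N\<^sup>2 + N + 1) * l\<^sup>2 * ?s - (1 + N * (2 * N + 1) * ?s) * l + N\<^sup>2)"
      by (simp only:) (simp add: power2_eq_square algebra_simps)
    also have "\<dots> < 0"
      using quadratic_pos_of_laguerre[OF N(1) _ t_bound l lag] \<gamma> by (simp add: mult_neg_pos)
    finally show ?thesis using l N by (simp add: mult_less_0_iff)
  qed
  then have "(N + 1) * (G (Suc n) * ?p) < 0" unfolding G' using p by (simp add: mult_pos_neg)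
  then show ?thesis using N by (simp add: mult_less_0_iff)
qed

end

subsection \<open>Zeros of \<open>F_poly\<close> and interlacing\<close>

lemma legendre_sequence_narayana_B:
  assumes "x < 0"
  shows "legendre_sequence ((1 + x) / (1 - x)) (\<lambda>n. poly (narayana_B n) x / (1 - x) ^ n)"
proof
  show "poly (narayana_B 0) x / (1 - x) ^ 0 = 1"
    "poly (narayana_B 1) x / (1 - x) ^ 1 = (1 + x) / (1 - x)"
    by (simp_all add: narayana_B_def poly_monom)
  show "((1 + x) / (1 - x))\<^sup>2 < 1"
  proof -
    have "(1 + x)\<^sup>2 < (1 - x)\<^sup>2" using assms by (simp add: power2_eq_square algebra_simps)
    then show ?thesis using assms by (simp add: power_divide)
  qed
  fix n
  have "(real n + 2) * (poly (narayana_B (Suc (Suc n))) x / (1 - x) ^ Suc (Suc n)) =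
    ((2 * real n + 3) * (1 + x) * poly (narayana_B (Suc n)) x
      - (real n + 1) * (1 - x)\<^sup>2 * poly (narayana_B n) x) / (1 - x) ^ Suc (Suc n)"
    using poly_narayana_B_recurrence[of n x] by simp
  also have "\<dots> = (2 * real n + 3) * ((1 + x) / (1 - x)) * (poly (narayana_B (Suc n)) x / (1 - x) ^ Suc n)
      - (real n + 1) * (poly (narayana_B n) x / (1 - x) ^ n)"
    using assms by (simp add: diff_divide_distrib power2_eq_square)
  finally show "(real n + 2) * (poly (narayana_B (Suc (Suc n))) x / (1 - x) ^ Suc (Suc n)) = \<dots>" .
qed

text \<open>Transfers \<open>next_term_sign\<close> to polynomials: the powers of 1 - x divided out
  are positive.\<close>

lemma F_poly_sign_at_zero:
  assumes "x < 0" "\<alpha> > 0" "\<alpha> + \<beta> \<ge> 0" "n \<ge> 1 \<or> \<alpha> + \<beta> > 0"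
    and "poly (F_poly (Suc (Suc n)) \<alpha> \<beta>) x = 0"
  shows "poly (F_poly (Suc (Suc (Suc n))) \<alpha> \<beta>) x * poly (narayana_B (Suc n)) x < 0"
proof -
  define t where "t = (1 + x) / (1 - x)"
  define p where "p n = poly (narayana_B n) x / (1 - x) ^ n" for n
  interpret legendre_sequence t p
    unfolding t_def p_def using assms(1) by (rule legendre_sequence_narayana_B)
  have G: "\<alpha> * p (Suc (Suc k)) + \<beta> / 2 * (t * p (Suc k) - p k)
      = poly (F_poly (Suc (Suc k)) \<alpha> \<beta>) x / (1 - x) ^ Suc (Suc k)" for k
  proof -
    define v where "v = 1 - x"
    have "v \<noteq> 0" using assms(1) by (simp add: v_def)
    then show ?thesis
      unfolding poly_F_poly p_def t_def v_def[symmetric] by (simp add: field_simps power2_eq_square)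
  qed
  have "poly (F_poly (Suc (Suc (Suc n))) \<alpha> \<beta>) x / (1 - x) ^ Suc (Suc (Suc n))
      * p (Suc n) < 0"
    using next_term_sign[of \<alpha> \<beta> n] assms unfolding G by simp
  moreover have "(1 - x) ^ Suc (Suc (Suc n)) * (1 - x) ^ Suc n > 0"
    using assms(1) by (intro mult_pos_pos zero_less_power) simp_all
  ultimately show ?thesis
    unfolding p_def times_divide_times_eq divide_less_0_iff by linarith
qed

text \<open>The recurrence trades (1 - x)^2 times the polynomial of index n for the one of index n +
  2. For \<alpha> > 0 and \<alpha> + \<beta> \<ge> 0 the factor on the right is positive unless n =
  0 and \<beta> = -\<alpha>.\<close>

lemma F_poly_at_narayana_B_zero:
  assumes "poly (narayana_B (Suc n)) x = 0"
  shows "2 * (real n + 1) * poly (F_poly (Suc (Suc n)) \<alpha> \<beta>) x =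
     ((real n + 2) * (\<alpha> + \<beta>) + real n * \<alpha>) * poly (narayana_B (Suc (Suc n))) x"
proof -
  have "(real n + 2) * poly (narayana_B (Suc (Suc n))) x =
      - ((real n + 1) * ((1 - x)\<^sup>2 * poly (narayana_B n) x))"
    using poly_narayana_B_recurrence[of n x] assms by simp
  moreover have "2 * (real n + 1) * poly (F_poly (Suc (Suc n)) \<alpha> \<beta>) x =
      2 * (real n + 1) * \<alpha> * poly (narayana_B (Suc (Suc n))) x
      - \<beta> * ((real n + 1) * ((1 - x)\<^sup>2 * poly (narayana_B n) x))"
    unfolding poly_F_poly by (simp add: assms algebra_simps)
  ultimately show ?thesis by algebra
qed

section \<open>Zeros of the Narayana polynomials\<close>

text \<open>The sign condition is the input of \<open>simple_zeros_Suc\<close> for the next degree.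
  It is inherited because at a zero of the middle polynomial the recurrence gives its two neighbours
  opposite signs.\<close>

lemma narayana_B_zeros:
  obtains z where "simple_zeros (narayana_B n) n z" "\<And>i. i < n \<Longrightarrow> z i < 0"
    "\<And>i. i < n \<Longrightarrow> (-1) ^ i * poly (narayana_B (Suc n)) (z i) < 0"
proof (induction n arbitrary: thesis)
  case 0
  have "simple_zeros (narayana_B 0) 0 (\<lambda>_. 0)"
    by (simp add: simple_zeros_def coeff_narayana_B)
  then show ?case by (rule 0) simp_all
next
  case (Suc n)
  from Suc.IH obtain z where z: "simple_zeros (narayana_B n) n z" "\<And>i. i < n \<Longrightarrow> z i < 0"
    "\<And>i. i < n \<Longrightarrow> (-1) ^ i * poly (narayana_B (Suc n)) (z i) < 0" by blast
  obtain y where y: "simple_zeros (narayana_B (Suc n)) (Suc n) y" "\<And>i. i < Suc n \<Longrightarrow> y i < 0"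
    "\<And>i. i < Suc n \<Longrightarrow> (-1) ^ i * poly (narayana_B n) (y i) > 0"
    by (rule simple_zeros_Suc[OF z(1,2) _ _ _ z(3)]) (simp_all add: coeff_narayana_B)
  show ?case
  proof (rule Suc.prems[OF y(1,2)])
    fix i assume i: "i < Suc n"
    have "poly (narayana_B (Suc n)) (y i) = 0" using y(1) i by (simp add: simple_zeros_def)
    then have rec: "(real n + 2) * poly (narayana_B (Suc (Suc n))) (y i) =
        - ((real n + 1) * (1 - y i)\<^sup>2 * poly (narayana_B n) (y i))"
      using poly_narayana_B_recurrence[of n "y i"] by simp
    have "(real n + 2) * ((-1) ^ i * poly (narayana_B (Suc (Suc n))) (y i)) =
        (-1) ^ i * ((real n + 2) * poly (narayana_B (Suc (Suc n))) (y i))"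
      by (rule mult.left_commute)
    also have "\<dots> = - ((real n + 1) * (1 - y i)\<^sup>2 * ((-1) ^ i * poly (narayana_B n) (y i)))"
      unfolding rec by simp
    also have "\<dots> < 0" using y(2,3)[OF i] by simp
    finally show "(-1) ^ i * poly (narayana_B (Suc (Suc n))) (y i) < 0"
      by (simp add: mult_less_0_iff)
  qed auto
qed

text \<open>At the n + 1 zeros of \<open>narayana_B (Suc n)\<close>, \<open>narayana_A n\<close> is
  a negative multiple of \<open>narayana_B (Suc (Suc n))\<close>, so it alternates in sign and has a
  zero in each of the n gaps.\<close>

lemma narayana_A_zeros:
  obtains y where "simple_zeros (narayana_A n) n y" "\<And>i. i < n \<Longrightarrow> y i < 0"
    "\<And>i. i < n \<Longrightarrow> (-1) ^ i * poly (narayana_A (Suc n)) (y i) < 0"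
proof -
  obtain z where z: "simple_zeros (narayana_B (Suc n)) (Suc n) z" "\<And>i. i < Suc n \<Longrightarrow> z i < 0"
    "\<And>i. i < Suc n \<Longrightarrow> (-1) ^ i * poly (narayana_B (Suc (Suc n))) (z i) < 0"
    using narayana_B_zeros[of "Suc n"] by blast
  have z_less: "z j < z i" if "i < j" "j \<le> n" for i j
    using z(1) that by (simp add: simple_zeros_def)
  have A_sign: "(-1) ^ i * poly (narayana_A n) (z i) > 0" if i: "i \<le> n" for i
  proof -
    have B: "poly (narayana_B (Suc n)) (z i) = 0" using z(1) i by (simp add: simple_zeros_def)
    have "2 * (real n + 1) * z i * ((-1) ^ i * poly (narayana_A n) (z i)) =
        (-1) ^ i * poly (narayana_B (Suc (Suc n))) (z i)"
    proof -
      have "(real n + 2) * (2 * (real n + 1) * (z i * poly (narayana_A n) (z i))) =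
          (real n + 2) * poly (narayana_B (Suc (Suc n))) (z i)"
        using poly_narayana_A[of n "z i"] poly_narayana_B_recurrence[of n "z i"] unfolding B
        by algebra
      then show ?thesis by simp
    qed
    also have "\<dots> < 0" using z(3) i by simp
    finally have "2 * (real n + 1) * z i * ((-1) ^ i * poly (narayana_A n) (z i)) < 0" .
    moreover have "2 * (real n + 1) * z i < 0" using z(2)[of i] i by (simp add: mult_pos_neg)
    ultimately show ?thesis by (meson mult_less_0_iff order_less_asym)
  qed
  obtain y where y: "\<And>i. i < n \<Longrightarrow> z (Suc i) < y i" "\<And>i. i < n \<Longrightarrow> y i < z i"
    "\<And>i. i < n \<Longrightarrow> poly (narayana_A n) (y i) = 0" "\<And>i j. i < j \<Longrightarrow> j < n \<Longrightarrow> y j < y i"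
    by (rule alternating_signs_imp_zeros[OF z_less A_sign]) (assumption | (rule that; assumption))+
  show ?thesis
  proof (rule that)
    show "simple_zeros (narayana_A n) n y"
      using y(3,4) by (simp add: simple_zeros_def coeff_narayana_A)
    show neg: "y i < 0" if "i < n" for i using y(2)[of i] z(2)[of i] that by simp
    fix i assume i: "i < n"
    \<comment> \<open>y i lies between z (i + 1) and z i, so exactly i + 1 zeros lie above
      it.\<close>
    have "(-1) ^ Suc i * poly (narayana_B (Suc n)) (y i) > 0"
    proof (rule simple_zeros_sign[OF z(1)])
      show "y i < z j" if "j < Suc i" for j
        using y(2)[OF i] z_less[of j i] that i by (cases "j = i") auto
      show "z j < y i" if "Suc i \<le> j" "j < Suc n" for j
        using y(1)[OF i] z_less[of "Suc i" j] that by (cases "j = Suc i") auto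
    qed (use i in simp)
    moreover have "(real n + 3) * poly (narayana_A (Suc n)) (y i) = 2 * poly (narayana_B (Suc n)) (y i)"
    proof -
      let ?A = "poly (narayana_A (Suc n)) (y i)" and ?B = "\<lambda>k. poly (narayana_B k) (y i)"
      have "(1 + y i) * ?B (Suc n) = (1 - y i)\<^sup>2 * ?B n"
        using poly_narayana_A[of n "y i"] y(3)[OF i] by simp
      then have "(real n + 2) * ?B (Suc (Suc n)) = (real n + 2) * ((1 + y i) * ?B (Suc n))"
        using poly_narayana_B_recurrence[of n "y i"] by algebra
      then have B: "?B (Suc (Suc n)) = (1 + y i) * ?B (Suc n)" by simp
      \<comment> \<open>The factor on the right comes from (1 + y)^2 - (1 - y)^2 = 4 y.\<close>
      have "2 * y i * ((real n + 3) * ?A) = 2 * y i * (2 * ?B (Suc n))"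
        using poly_narayana_A[of "Suc n" "y i"] unfolding B
        by (simp add: power2_eq_square algebra_simps)
      then show ?thesis using neg[OF i] by simp
    qed
    ultimately have "(real n + 3) * ((-1) ^ i * poly (narayana_A (Suc n)) (y i)) < 0"
      by (simp add: mult.left_commute)
    then show "(-1) ^ i * poly (narayana_A (Suc n)) (y i) < 0"
      by (simp add: mult_less_0_iff)
  qed
qed

section \<open>Interlacing in the generic case and the two degenerate ones\<close>

text \<open>\<open>simple_zeros_Suc\<close> is applied twice: from \<open>narayana_B (Suc n)\<close>
  to the first F, then from the first F to the second. The signs of
  \<open>narayana_B (Suc n)\<close> obtained in the first round feed the second.\<close>

lemma F_poly_interlaces_generic:
  assumes "\<alpha> > 0" "\<alpha> + \<beta> \<ge> 0" "n \<ge> 1 \<or> \<alpha> + \<beta> > 0"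
  shows "F_poly (Suc (Suc n)) \<alpha> \<beta> \<preceq> F_poly (Suc (Suc (Suc n))) \<alpha> \<beta>"
proof -
  let ?F = "\<lambda>k. F_poly (Suc (Suc k)) \<alpha> \<beta>"
  have F: "degree (?F k) = Suc (Suc k)" "lead_coeff (?F k) > 0" "poly (?F k) 0 > 0" for k
    using assms(1) by (simp_all add: degree_F_poly coeff_F_poly_n poly_F_poly)
  obtain z where z: "simple_zeros (narayana_B (Suc n)) (Suc n) z" "\<And>i. i < Suc n \<Longrightarrow> z i < 0"
    "\<And>i. i < Suc n \<Longrightarrow> (-1) ^ i * poly (narayana_B (Suc (Suc n))) (z i) < 0"
    using narayana_B_zeros[of "Suc n"] by blast
  have F_sign: "(-1) ^ i * poly (?F n) (z i) < 0" if i: "i < Suc n" for i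
  proof -
    define c where "c = (real n + 2) * (\<alpha> + \<beta>) + real n * \<alpha>"
    have "(real n + 2) * (\<alpha> + \<beta>) \<ge> 0" "real n * \<alpha> \<ge> 0"
      "(real n + 2) * (\<alpha> + \<beta>) > 0 \<or> real n * \<alpha> > 0"
      using assms by auto
    then have "c > 0" unfolding c_def by linarith
    have "poly (narayana_B (Suc n)) (z i) = 0" using z(1) i by (simp add: simple_zeros_def)
    from F_poly_at_narayana_B_zero[OF this, of \<alpha> \<beta>]
    have "2 * (real n + 1) * ((-1) ^ i * poly (?F n) (z i)) =
        c * ((-1) ^ i * poly (narayana_B (Suc (Suc n))) (z i))"
      unfolding c_def by (simp only: mult.left_commute)
    also have "\<dots> < 0" using z(3)[OF i] \<open>c > 0\<close> by (rule mult_pos_neg[rotated])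
    finally show ?thesis by (simp add: mult_less_0_iff)
  qed
  obtain y where y: "simple_zeros (?F n) (Suc (Suc n)) y" "\<And>i. i < Suc (Suc n) \<Longrightarrow> y i < 0"
    "\<And>i. i < Suc (Suc n) \<Longrightarrow> (-1) ^ i * poly (narayana_B (Suc n)) (y i) > 0"
    by (rule simple_zeros_Suc[OF z(1,2) F F_sign]) (assumption | (rule that; assumption))+
  have F_sign': "(-1) ^ i * poly (?F (Suc n)) (y i) < 0" if i: "i < Suc (Suc n)" for i
  proof -
    have "poly (?F n) (y i) = 0" using y(1) i by (simp add: simple_zeros_def)
    from F_poly_sign_at_zero[OF y(2)[OF i] assms this]
    show ?thesis using y(3)[OF i] by (auto simp: mult_less_0_iff zero_less_mult_iff)
  qed
  obtain r where "simple_zeros (?F (Suc n)) (Suc (Suc (Suc n))) r"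
    "\<And>i. i < Suc (Suc n) \<Longrightarrow> y i < r i" "\<And>i. i < Suc (Suc n) \<Longrightarrow> r (Suc i) < y i"
    by (rule simple_zeros_Suc[OF y(1,2) F F_sign']) (assumption | (rule that; assumption))+
  with y(1) show ?thesis by (rule simple_zeros_interlaces)
qed

lemma F_poly_interlaces_type_A:
  assumes "\<beta> > 0"
  shows "F_poly (Suc (Suc n)) 0 \<beta> \<preceq> F_poly (Suc (Suc (Suc n))) 0 \<beta>"
proof -
  obtain y where y: "simple_zeros (narayana_A n) n y" "\<And>i. i < n \<Longrightarrow> y i < 0"
    "\<And>i. i < n \<Longrightarrow> (-1) ^ i * poly (narayana_A (Suc n)) (y i) < 0"
    using narayana_A_zeros[of n] by blast
  have lc: "lead_coeff (narayana_A k) > 0" for k by (simp add: coeff_narayana_A)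
  obtain r where r: "simple_zeros (narayana_A (Suc n)) (Suc n) r" "\<And>i. i < Suc n \<Longrightarrow> r i < 0"
    "\<And>i. i < n \<Longrightarrow> y i < r i" "\<And>i. i < n \<Longrightarrow> r (Suc i) < y i"
    by (rule simple_zeros_Suc[OF y(1,2) _ lc _ y(3)]) simp_all
  \<comment> \<open>The factor x puts the common zero 0 at the head of both lists and shifts the
    negative zeros by one place.\<close>
  have F: "F_poly (Suc (Suc k)) 0 \<beta> = smult (\<beta> * real (Suc (Suc k)) * lead_coeff (narayana_A k))
      (linear_factors (0 # map x [0..<k]))" if "simple_zeros (narayana_A k) k x" for k x
  proof -
    have "F_poly (Suc (Suc k)) 0 \<beta> = smult (\<beta> * real (Suc (Suc k))) ([:0, 1:] * narayana_A k)"
      by (simp add: F_poly_def)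
    also have "narayana_A k = smult (lead_coeff (narayana_A k)) (linear_factors (map x [0..<k]))"
      using that by (rule simple_zeros_factorisation)
    finally show ?thesis by simp
  qed
  show ?thesis
  proof (rule interlaces_linear_factors[OF F[OF y(1)] F[OF r(1)]])
    show "(0 # map y [0..<n]) ! i \<le> (0 # map r [0..<Suc n]) ! i"
      if "i < length (0 # map y [0..<n])" for i
      using that r(3) by (cases i) (simp_all add: less_imp_le del: upt_Suc)
    show "(0 # map r [0..<Suc n]) ! (i + 1) \<le> (0 # map y [0..<n]) ! i"
      if "i + 1 < length (0 # map r [0..<Suc n])" for i
      using that r(2,4) by (cases i) (simp_all add: less_imp_le del: upt_Suc)
    show "sorted_wrt (\<ge>) (0 # map y [0..<n])"
      using simple_zeros_sorted[OF y(1)] y(2) by (auto intro: less_imp_le)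
    show "sorted_wrt (\<ge>) (0 # map r [0..<Suc n])"
      using simple_zeros_sorted[OF r(1)] r(2) by (auto intro: less_imp_le simp del: upt_Suc)
  qed (use assms lc in \<open>simp_all del: upt_Suc of_nat_Suc\<close>)
qed

text \<open>Here the polynomials are \<alpha> (1 + x)^2 and \<alpha> (1 + x)(x^2 + 5 x + 1), which
  share the zero -1, so the zeros are compared explicitly.\<close>

lemma F_poly_interlaces_double_zero:
  assumes "\<alpha> > 0"
  shows "F_poly 2 \<alpha> (- \<alpha>) \<preceq> F_poly 3 \<alpha> (- \<alpha>)"
proof -
  have A: "narayana_A 0 = [:1:]" "narayana_A 1 = [:1, 1:]"
    by (simp_all add: narayana_A_def monom_0 monom_Suc)
  have B: "narayana_B 2 = [:1, 4, 1:]" "narayana_B 3 = [:1, 9, 9, 1:]"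
    by (simp_all add: narayana_B_def monom_0 monom_Suc numeral_eq_Suc)
  have sqrt21: "3 < sqrt 21" "sqrt 21 < 5" "sqrt 21 * sqrt 21 = 21"
    by (simp_all add: real_less_rsqrt real_less_lsqrt)
  have "F_poly 2 \<alpha> (- \<alpha>) = smult \<alpha> (linear_factors [-1, -1])"
    by (simp add: F_poly_def A B algebra_simps)
  moreover have "F_poly 3 \<alpha> (- \<alpha>) =
      smult \<alpha> (linear_factors [(- 5 + sqrt 21) / 2, -1, (- 5 - sqrt 21) / 2])"
    using A(2) by (simp add: F_poly_def B field_simps sqrt21(3))
  ultimately show ?thesis
    by (rule interlaces_linear_factors)
      (use assms sqrt21 in \<open>auto simp: nth_Cons less_Suc_eq split: nat.split\<close>)
qed

theorem mainTheorem2: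
  fixes \<alpha> \<beta> :: real and n :: nat
  assumes "\<alpha> \<ge> 0" and "\<alpha> + \<beta> \<ge> 0" and "(\<alpha>, \<beta>) \<noteq> (0, 0)"
    and "n \<ge> 2"
  shows "F_poly n \<alpha> \<beta> \<preceq> F_poly (n + 1) \<alpha> \<beta>"
proof -
  obtain k where n: "n = Suc (Suc k)"
    using assms(4) by (metis add_2_eq_Suc le_Suc_ex)
  \<comment> \<open>In the first case the hypotheses force \<beta> > 0.\<close>
  consider "\<alpha> = 0" | "\<alpha> > 0" "k \<ge> 1 \<or> \<alpha> + \<beta> > 0" | "\<alpha> > 0" "k = 0" "\<beta> = - \<alpha>"
    using assms(1,2) by linarith
  then show ?thesis
  proof cases
    case 1
    then show ?thesis using F_poly_interlaces_type_A[of \<beta> k] assms by (simp add: n)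
  next
    case 2
    then show ?thesis using F_poly_interlaces_generic[of \<alpha> \<beta> k] assms by (simp add: n)
  next
    case 3
    then show ?thesis
      using F_poly_interlaces_double_zero[of \<alpha>] by (simp add: n numeral_eq_Suc)
  qed
qed

end
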